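(* Let $x_1,x_2,x_3,x_4$ be four distinct points in a plane of $\mathbb R^3$ which are the consecutive vertices of a cyclic quadrilateral (i.e. they lie, in this cyclic order, on a circle). Then the weak Four Points Conjecture holds for them: (with $V=0$) $$\Re(D_4)-\Bigl(4+\tfrac34\Bigr)\cdot 288V^2\ \ge\ 64\prod_{1\le i<j\le 4}r_{ij}+\sum_{l=1}^4\Bigl(4+\tfrac14\,\frac{d_3(r_{ij},r_{ik},r_{jk})}{r_{ij}r_{ik}r_{jk}}\Bigr)r_{il}r_{jl}r_{kl}\,d_3(r_{ij},r_{ik},r_{jk}),$$ where for each $l$ one writes $\{1,2,3,4\}\setminus\{l\}=\{i<j<k\}$.
   Context: Put $d_3(a,b,c)=(a+b-c)(b+c-a)(c+a-b)$. For distinct points $x_1,\dots,x_4\in\mathbb R^3$ let $r_{ij}=|x_i-x_j|$, and let $V$ be the volume of the tetrahedron with these vertices ($V=0$ if coplanar). The (non-normalized) Atiyah determinant $D_4\in\mathbb C$ is defined as follows. Identify $S^2$ with $\mathbb{CP}^1=\mathbb C\cup\{\infty\}$ by stereographic projection, so that the antipode of $t$ is $-1/\bar t$. For $i\ne j$ let $t_{ij}$ be the point corresponding to the unit vector $(x_j-x_i)/r_{ij}$. For each pair $i<j$ choose a unit vector $(\alpha,\beta)\in\mathbb C^2$ such that $\ell_{ij}(t)=\alpha t+\beta$ has root $t_{ij}$ (with $\alpha=0$ if $t_{ij}=\infty$), and put $\ell_{ji}(t)=-\bar\beta t+\bar\alpha$ (which has root $t_{ji}$). Let $p_i(t)=\prod_{j\ne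 i}\ell_{ij}(t)=\sum_{j=1}^4 m_{ij}t^{j-1}$ and $D_4=64\prod_{1\le i<j\le4}r_{ij}\cdot\det(m_{ij})$; this does not depend on the choices. Known fact (Eastwood–Norbury): $$\Re(D_4)=64\prod_{i<j}r_{ij}-4d_3(r_{12}r_{34},r_{13}r_{24},r_{14}r_{23})+A_4+288V^2,$$ $$A_4=\sum_{l=1}^4\Bigl(\sum_{i\ne l}r_{li}\bigl((r_{lj}+r_{lk})^2-r_{jk}^2\bigr)\Bigr)d_3(r_{ij},r_{ik},r_{jk}),\qquad \{j,k\}=\{1,2,3,4\}\setminus\{l,i\}.$$ *)

theory Defs
  imports "HOL-Analysis.Analysis" "HOL-Computational_Algebra.Polynomial"
begin

definition d3 :: "real \<Rightarrow> real \<Rightarrow> real \<Rightarrow> real" where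
  "d3 a b c = (a + b - c) * (b + c - a) * (c + a - b)"

(* Stereographic projection from the north pole onto the equatorial plane;
   None is the point at infinity of CP^1. *)
definition stereo :: "real^3 \<Rightarrow> complex option" where
  "stereo u = (if u $ 3 = 1 then None
               else Some (Complex (u $ 1) (u $ 2) / complex_of_real (1 - u $ 3)))"

definition antipode :: "complex option \<Rightarrow> complex option" where
  "antipode t = (case t of None \<Rightarrow> Some 0
                 | Some z \<Rightarrow> if z = 0 then None else Some (- 1 / cnj z))"

(* Root in CP^1 of the linear form [:b, a:] = a t + b. *)
definition root_at :: "complex \<Rightarrow> complex \<Rightarrow> complex option \<Rightarrow> bool" where
  "root_at a b t = (case t of None \<Rightarrow> a = 0 | Some z \<Rightarrow> poly [:b, a:] z = 0)"

definition dir_pt :: "(nat \<Rightarrow> real^3) \<Rightarrow> nat \<Rightarrow> nat \<Rightarrow> complex option" where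
  "dir_pt x i j = stereo ((x j - x i) /\<^sub>R dist (x i) (x j))"

(* The points are x 1, ..., x 4.  Unit lifts are chosen only for i < j; interchanging the roles of
   i and j in lin_form for a single pair would change the sign of the determinant. *)
definition admissible ::
    "(nat \<Rightarrow> real^3) \<Rightarrow> (nat \<Rightarrow> nat \<Rightarrow> complex) \<Rightarrow> (nat \<Rightarrow> nat \<Rightarrow> complex) \<Rightarrow> bool" where
  "admissible x a b \<longleftrightarrow>
     (\<forall>i\<in>{1..4}. \<forall>j\<in>{1..4}. i < j \<longrightarrow>
        (cmod (a i j))\<^sup>2 + (cmod (b i j))\<^sup>2 = 1 \<and> root_at (a i j) (b i j) (dir_pt x i j))"

definition lin_form ::
    "(nat \<Rightarrow> nat \<Rightarrow> complex) \<Rightarrow> (nat \<Rightarrow> nat \<Rightarrow> complex) \<Rightarrow> nat \<Rightarrow> nat \<Rightarrow> complex poly" where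
  "lin_form a b i j = (if i < j then [:b i j, a i j:] else [:cnj (a j i), - cnj (b j i):])"

definition atiyah_poly ::
    "(nat \<Rightarrow> nat \<Rightarrow> complex) \<Rightarrow> (nat \<Rightarrow> nat \<Rightarrow> complex) \<Rightarrow> nat \<Rightarrow> complex poly" where
  "atiyah_poly a b i = (\<Prod>j\<in>{1..4} - {i}. lin_form a b i j)"

definition atiyah_matrix ::
    "(nat \<Rightarrow> nat \<Rightarrow> complex) \<Rightarrow> (nat \<Rightarrow> nat \<Rightarrow> complex) \<Rightarrow> complex^4^4" where
  "atiyah_matrix a b =
     vector (map (\<lambda>i. vector (map (\<lambda>j. coeff (atiyah_poly a b i) (j - 1)) [1, 2, 3, 4])) [1, 2, 3, 4])"

definition edge_prod :: "(nat \<Rightarrow> real^3) \<Rightarrow> real" where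
  "edge_prod x = (\<Prod>(i, j)\<in>{(i, j). i \<in> {1..4} \<and> j \<in> {1..4} \<and> i < j}. dist (x i) (x j))"

(* The value does not depend on the admissible lifts a, b, which exist by admissible_exists;
   no particular choice is singled out. *)
definition atiyah_D4 ::
    "(nat \<Rightarrow> real^3) \<Rightarrow> (nat \<Rightarrow> nat \<Rightarrow> complex) \<Rightarrow> (nat \<Rightarrow> nat \<Rightarrow> complex) \<Rightarrow> complex" where
  "atiyah_D4 x a b = 64 * complex_of_real (edge_prod x) * det (atiyah_matrix a b)"

(* The angles increase through less than one full turn.  As the orthonormal frame (u, v) may be
   reversed, this covers both senses of traversal of the circle. *)
definition consecutive_on_circle :: "(nat \<Rightarrow> real^3) \<Rightarrow> bool" where
  "consecutive_on_circle x \<longleftrightarrow>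
     (\<exists>c u v \<rho> \<theta>. \<rho> > 0 \<and> norm u = 1 \<and> norm v = 1 \<and> u \<bullet> v = 0 \<and>
        \<theta> 1 < \<theta> 2 \<and> \<theta> 2 < \<theta> 3 \<and> \<theta> 3 < \<theta> 4 \<and> \<theta> 4 < \<theta> 1 + 2 * pi \<and>
        (\<forall>i\<in>{1..4}. x i = c + \<rho> *\<^sub>R (cos (\<theta> i) *\<^sub>R u + sin (\<theta> i) *\<^sub>R v)))"

definition tetra_volume :: "(nat \<Rightarrow> real^3) \<Rightarrow> real" where
  "tetra_volume x = measure lebesgue (convex hull (x ` {1..4}))"

lemma vector_4:
  "vector [p, q, r, s] $ (1 :: 4) = (p :: 'a :: zero)"
  "vector [p, q, r, s] $ (2 :: 4) = q"
  "vector [p, q, r, s] $ (3 :: 4) = r"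
  "vector [p, q, r, s] $ (4 :: 4) = s"
  by (simp_all add: vector_def)

lemma edge_prod_expand:
  "edge_prod x = dist (x 1) (x 2) * dist (x 1) (x 3) * dist (x 1) (x 4) *
     dist (x 2) (x 3) * dist (x 2) (x 4) * dist (x 3) (x 4)"
proof -
  have "{(i, j). i \<in> {1..4} \<and> j \<in> {1..4} \<and> i < j} =
        {(1, 2), (1, 3), (1, 4), (2, 3), (2, 4), (3, 4 :: nat)}" (is "?S = _")
    by (auto simp: numeral_eq_Suc)
  then show ?thesis by (simp add: edge_prod_def)
qed

(* Together with root_at_antipode: lin_form a b j i has the root dir_pt x j i as well. *)
lemma stereo_antipode:
  assumes "norm u = 1"
  shows "stereo (- u) = antipode (stereo u)"
proof -
  have n: "(u $ 1)\<^sup>2 + (u $ 2)\<^sup>2 + (u $ 3)\<^sup>2 = 1"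
    using assms by (simp add: norm_vec_def L2_set_def sum_3)
  consider "u $ 3 = 1" | "u $ 3 = -1" | "u $ 3 \<noteq> 1" "u $ 3 \<noteq> -1" by blast
  then show ?thesis
  proof cases
    case 3
    have p: "(u $ 1)\<^sup>2 + (u $ 2)\<^sup>2 = (1 - u $ 3) * (1 + u $ 3)"
      using n by (simp add: algebra_simps power2_eq_square)
    then have nz: "(u $ 1)\<^sup>2 + (u $ 2)\<^sup>2 \<noteq> 0" using 3 by auto
    have "- u $ 3 \<noteq> 1" "Complex (u $ 1) (u $ 2) \<noteq> 0" "1 + u $ 3 \<noteq> 0"
      using 3 nz by (auto simp: complex_eq_iff)
    moreover have "Complex (- u $ 1) (- u $ 2) * cnj (Complex (u $ 1) (u $ 2)) =
        - complex_of_real ((1 - u $ 3) * (1 + u $ 3))"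
      unfolding p[symmetric] by (simp add: complex_eq_iff power2_eq_square)
    ultimately show ?thesis using 3
      by (simp add: stereo_def antipode_def divide_simps flip: of_real_add)
  next
    case 1
    then have "u $ 1 = 0 \<and> u $ 2 = 0" using n by (simp add: sum_power2_eq_zero_iff)
    with 1 show ?thesis by (simp add: stereo_def antipode_def complex_eq_iff)
  next
    case 2
    then have "u $ 1 = 0 \<and> u $ 2 = 0" using n by (simp add: sum_power2_eq_zero_iff)
    with 2 show ?thesis by (simp add: stereo_def antipode_def complex_eq_iff)
  qed
qed

lemma root_at_antipode:
  assumes "root_at a b t"
  shows "root_at (- cnj b) (cnj a) (antipode t)"
proof (cases t)
  case None
  then show ?thesis using assms by (simp add: root_at_def antipode_def)
next
  case (Some z)
  then have "b + z * a = 0" using assms by (simp add: root_at_def)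
  then have "cnj b + cnj z * cnj a = 0"
    by (metis complex_cnj_add complex_cnj_mult complex_cnj_zero)
  then show ?thesis
    using Some by (auto simp: root_at_def antipode_def field_simps)
qed

lemma root_at_exists: "\<exists>a b. (cmod a)\<^sup>2 + (cmod b)\<^sup>2 = 1 \<and> root_at a b t"
proof (cases t)
  case None
  then show ?thesis by (intro exI[of _ 0] exI[of _ 1]) (simp add: root_at_def)
next
  case (Some z)
  define s where "s = sqrt (1 + (cmod z)\<^sup>2)"
  have s: "s\<^sup>2 = 1 + (cmod z)\<^sup>2" "s \<noteq> 0" "1 + (cmod z)\<^sup>2 \<noteq> 0"
    by (auto simp: s_def add_nonneg_eq_0_iff)
  show ?thesis
    by (rule exI[of _ "complex_of_real (1 / s)"], rule exI[of _ "- z / complex_of_real s"])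
       (use s in \<open>simp add: Some root_at_def norm_divide power_divide flip: add_divide_distrib\<close>)
qed

lemma admissible_exists: "\<exists>a b. admissible x a b"
proof -
  have "\<forall>i j. \<exists>p. (cmod (fst p))\<^sup>2 + (cmod (snd p))\<^sup>2 = 1 \<and>
          root_at (fst p) (snd p) (dir_pt x i j)"
    using root_at_exists by (metis fst_conv snd_conv)
  then obtain p where "\<forall>i j. (cmod (fst (p i j)))\<^sup>2 + (cmod (snd (p i j)))\<^sup>2 = 1 \<and>
          root_at (fst (p i j)) (snd (p i j)) (dir_pt x i j)"
    by metis
  then have "admissible x (\<lambda>i j. fst (p i j)) (\<lambda>i j. snd (p i j))"
    by (simp add: admissible_def)
  then show ?thesis by blast
qed

end

(* The vectors of the plane of the circle are the Re (eps * m) with m = u + i v isotropic in C^3, and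
   m is the square of a spinor.  After the corresponding change of basis in SU(2), which does not
   affect the determinant because its action on cubic forms has determinant 1, the direction from
   x_i to x_j has the root parameter y_i y_j for unit complex numbers y_i (half the polar angle of
   x_i, up to a constant).  Hence D_4 is an explicit Laurent polynomial in the y_i, and
     D_4 = (prod r_ij) * (64 + sum_l 2 Q_l (3 + c_l)),
   where Q_l = d_3 / (product of the sides) = 2 (cos A + cos B + cos C - 1) for the triangle that
   omits x_l, and c_l is the sum of the cosines of the three angles at x_l between the edges to the
   other points.  By the inscribed angle theorem these three angles are s, t and s + t with s, t
   angles of the triangle, and the inequality holds for each l separately because
     2 (3 + c_l) - 4 - Q_l / 4 = cos p (5 cos p + 3 cos d),   p = (s + t) / 2, d = (s - t) / 2. *)
theory Submission
  imports Defs
begin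

section \<open>Cofactor expansion of four by four determinants\<close>

lemma det_4:
  "det (A :: 'a::comm_ring_1^4^4) =
    A$1$1 * (A$2$2 * (A$3$3 * A$4$4 - A$3$4 * A$4$3) - A$2$3 * (A$3$2 * A$4$4 - A$3$4 * A$4$2)
      + A$2$4 * (A$3$2 * A$4$3 - A$3$3 * A$4$2))
  - A$1$2 * (A$2$1 * (A$3$3 * A$4$4 - A$3$4 * A$4$3) - A$2$3 * (A$3$1 * A$4$4 - A$3$4 * A$4$1)
      + A$2$4 * (A$3$1 * A$4$3 - A$3$3 * A$4$1))
  + A$1$3 * (A$2$1 * (A$3$2 * A$4$4 - A$3$4 * A$4$2) - A$2$2 * (A$3$1 * A$4$4 - A$3$4 * A$4$1)
      + A$2$4 * (A$3$1 * A$4$2 - A$3$2 * A$4$1))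
  - A$1$4 * (A$2$1 * (A$3$2 * A$4$3 - A$3$3 * A$4$2) - A$2$2 * (A$3$1 * A$4$3 - A$3$3 * A$4$1)
      + A$2$3 * (A$3$1 * A$4$2 - A$3$2 * A$4$1))"
proof -
  have f: "finite {2::4, 3, 4}" "1 \<notin> {2::4, 3, 4}" "finite {3::4, 4}" "2 \<notin> {3::4, 4}"
     "finite {4::4}" "3 \<notin> {4::4}" by auto
  show ?thesis
    unfolding det_def UNIV_4
    \<comment> \<open>Permutations are split by the image of one index at a time, until only the
      identity on a single index is left.\<close>
    unfolding sum_over_permutations_insert[OF f(1,2)]
    unfolding sum_over_permutations_insert[OF f(3,4)]
    unfolding sum_over_permutations_insert[OF f(5,6)]
    unfolding permutes_sing
    by (simp add: sign_swap_id permutation_swap_id sign_compose sign_id permutation_compose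
        transpose_apply_first transpose_def algebra_simps)
qed

section \<open>Binary cubic forms\<close>

text \<open>A pair (a, b) stands for the linear form a t + b.\<close>

definition cubic_row :: "'a::comm_ring_1 \<times> 'a \<Rightarrow> 'a \<times> 'a \<Rightarrow> 'a \<times> 'a \<Rightarrow> 'a^4" where
  "cubic_row = (\<lambda>(a1, b1) (a2, b2) (a3, b3). vector
    [b1 * b2 * b3, a1 * b2 * b3 + b1 * a2 * b3 + b1 * b2 * a3,
     a1 * a2 * b3 + a1 * b2 * a3 + b1 * a2 * a3, a1 * a2 * a3])"

lemma cubic_row_eq_coeff:
  "cubic_row (a1, b1) (a2, b2) (a3, b3) =
    vector (map (coeff ([:b1, a1:] * [:b2, a2:] * [:b3, a3:])) [0, 1, 2, 3])"
  by (simp add: cubic_row_def vec_eq_iff forall_4 vector_4 coeff_pCons numeral_eq_Suc algebra_simps)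

text \<open>The action on cubic forms of the substitution that sends the basis t, 1 to f, g.\<close>

definition sym3 :: "'a::comm_ring_1 \<times> 'a \<Rightarrow> 'a \<times> 'a \<Rightarrow> 'a^4^4" where
  "sym3 f g = vector [cubic_row g g g, cubic_row f g g, cubic_row f f g, cubic_row f f f]"

text \<open>The third symmetric power of a matrix with eigenvalues \<open>x\<close>,
  \<open>y\<close> has eigenvalues \<open>x^3\<close>, \<open>x^2 y\<close>, \<open>x y^2\<close>,
  \<open>y^3\<close>, whose product is the sixth power of the determinant. Hence a substitution from
  SU(2) leaves determinants of cubic forms unchanged.\<close>

lemma det_sym3: "det (sym3 (p, q) (r, s)) = (p * s - q * r) ^ 6" for p :: "'a::comm_ring_1"
  unfolding det_4 sym3_def cubic_row_def vector_4 prod.case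
  by (simp add: eval_nat_numeral algebra_simps)

lemma cubic_row_scale:
  "cubic_row (c1 * k1, c1 * m1) (c2 * k2, c2 * m2) (c3 * k3, c3 * m3) =
    (c1 * c2 * c3) *s cubic_row (k1, m1) (k2, m2) (k3, m3)"
  by (simp add: cubic_row_def vec_eq_iff forall_4 vector_4 algebra_simps)

text \<open>With \<open>f = (p, q)\<close> and \<open>g = (r, s)\<close> the factors on the left are
  \<open>k f + m g\<close>. Their product is a cubic form in \<open>f\<close> and \<open>g\<close>,
  and \<open>sym3\<close> rewrites it in the monomials of \<open>t\<close>.\<close>

lemma cubic_row_change:
  "cubic_row (k1 * p + m1 * r, k1 * q + m1 * s) (k2 * p + m2 * r, k2 * q + m2 * s)
      (k3 * p + m3 * r, k3 * q + m3 * s)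
    = cubic_row (k1, m1) (k2, m2) (k3, m3) v* sym3 (p, q) (r, s)"
  by (simp add: cubic_row_def sym3_def vector_matrix_mult_def vec_eq_iff forall_4 vector_4 sum_4
      algebra_simps)

lemma det_scaled_rows_mul:
  fixes S :: "'a::comm_ring_1^4^4"
  shows "det (vector [c1 *s (r1 v* S), c2 *s (r2 v* S), c3 *s (r3 v* S), c4 *s (r4 v* S)] :: 'a^4^4) =
    c1 * c2 * c3 * c4 * det (vector [r1, r2, r3, r4] :: 'a^4^4) * det S"
proof -
  let ?c = "vector [c1, c2, c3, c4] :: 'a^4" and ?N = "vector [r1, r2, r3, r4] :: 'a^4^4"
  have "vector [c1 *s (r1 v* S), c2 *s (r2 v* S), c3 *s (r3 v* S), c4 *s (r4 v* S)] =
      (\<chi> i. ?c $ i *s (?N ** S) $ i)" (is "?A = ?B")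
    by (simp add: vec_eq_iff forall_4 vector_4 vector_matrix_mult_def matrix_matrix_mult_def)
  moreover have "det ?B = prod (($) ?c) UNIV * (det ?N * det S)"
    by (subst det_rows_mul) (simp only: vec_lambda_eta det_mul)
  moreover have "prod (($) ?c) UNIV = c1 * c2 * c3 * c4"
    unfolding UNIV_4 by (simp add: vector_4 mult.assoc)
  ultimately show ?thesis by (simp only: mult.assoc)
qed

text \<open>This is the determinant in the basis adapted to the plane. For unit \<open>y\<close>,
  \<open>C i j\<close> is the cosine of half the angle difference, and each \<open>Q\<close> belongs
  to one omitted vertex. In the other factor a cosine has a minus sign exactly when the omitted
  index lies between its two indices, where the inscribed angle is a supplement. Over any field of
  characteristic 0 it is an identity of Laurent polynomials, checked by clearing
  denominators.\<close>

lemma det_concyclic: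
  fixes y :: "nat \<Rightarrow> 'a::field_char_0"
  assumes "\<And>i. y i \<noteq> 0"
  defines "e \<equiv> \<lambda>i j. (y i * y j, 1)" and "e' \<equiv> \<lambda>i j. (- 1, 1 / (y i * y j))"
  defines "C \<equiv> \<lambda>i j. (y i / y j + y j / y i) / 2"
  defines "Q \<equiv> \<lambda>i j k. 2 * (C i j + C j k - C i k - 1)"
  shows "det (vector [cubic_row (e 1 2) (e 1 3) (e 1 4), cubic_row (e' 1 2) (e 2 3) (e 2 4),
      cubic_row (e' 1 3) (e' 2 3) (e 3 4), cubic_row (e' 1 4) (e' 2 4) (e' 3 4)] :: 'a^4^4)
    = 64 + 2 * (Q 2 3 4 * (3 + C 2 3 + C 3 4 + C 2 4) + Q 1 3 4 * (3 + C 3 4 - C 1 4 - C 1 3) +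
        Q 1 2 4 * (3 + C 1 2 - C 2 4 - C 1 4) + Q 1 2 3 * (3 + C 1 2 + C 2 3 + C 1 3))"
  unfolding det_4 cubic_row_def vector_4 prod.case e_def e'_def C_def Q_def
  using assms(1)[of 1] assms(1)[of 2] assms(1)[of 3] assms(1)[of 4]
  by (simp add: divide_simps power2_eq_square) (simp add: algebra_simps)

section \<open>Spinors of a plane\<close>

text \<open>These are the Hopf coordinates, the quadratic expressions in a lift that ignore its
  phase. Away from the north pole the root equation gives the ratio of \<open>b\<close> to
  \<open>a\<close>, and the normalization then fixes both moduli; at the pole
  \<open>a = 0\<close>.\<close>

lemma unit_lift_coords:
  assumes e: "norm e = 1" and unit: "(cmod a)\<^sup>2 + (cmod b)\<^sup>2 = 1" and root: "root_at a b (stereo e)"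
  shows "(cmod a)\<^sup>2 = (1 - e $ 3) / 2" "(cmod b)\<^sup>2 = (1 + e $ 3) / 2"
    "b * cnj a = - Complex (e $ 1) (e $ 2) / 2"
proof -
  have n: "(e $ 1)\<^sup>2 + (e $ 2)\<^sup>2 + (e $ 3)\<^sup>2 = 1"
    using e by (simp add: norm_vec_def L2_set_def sum_3)
  have "(cmod a)\<^sup>2 = (1 - e $ 3) / 2 \<and> (cmod b)\<^sup>2 = (1 + e $ 3) / 2 \<and>
    b * cnj a = - Complex (e $ 1) (e $ 2) / 2"
  proof (cases "e $ 3 = 1")
    case True
    then have "e $ 1 = 0" "e $ 2 = 0" using n by (auto simp: sum_power2_eq_zero_iff)
    moreover have "a = 0" using root True by (simp add: root_at_def stereo_def)
    ultimately show ?thesis using unit True by (simp add: Complex_eq_0)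
  next
    case False
    define w where "w = Complex (e $ 1) (e $ 2)"
    define s where "s = 1 - e $ 3"
    have s: "s \<noteq> 0" using False by (simp add: s_def)
    have "b + w / of_real s * a = 0"
      using root False by (simp add: root_at_def stereo_def w_def s_def)
    then have b: "b = - (w / of_real s) * a" by (simp add: eq_neg_iff_add_eq_0)
    have "(cmod w)\<^sup>2 = (e $ 1)\<^sup>2 + (e $ 2)\<^sup>2" by (simp add: w_def cmod_power2)
    then have w: "(cmod w)\<^sup>2 = s * (2 - s)"
      using n by (simp add: s_def algebra_simps power2_eq_square)
    have "(cmod b)\<^sup>2 = (cmod w)\<^sup>2 / s\<^sup>2 * (cmod a)\<^sup>2"
      by (simp add: b norm_mult norm_divide power_mult_distrib power_divide)
    also have "\<dots> = (2 - s) / s * (cmod a)\<^sup>2"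
      unfolding w using s by (simp add: power2_eq_square)
    finally have "(cmod b)\<^sup>2 = (2 - s) / s * (cmod a)\<^sup>2" .
    with unit s have a: "(cmod a)\<^sup>2 = s / 2" by (simp add: field_simps)
    have "b * cnj a = - (w / of_real s) * of_real ((cmod a)\<^sup>2)"
      unfolding b complex_norm_square by simp
    also have "\<dots> = - w / 2" using s by (simp add: a)
    finally show ?thesis using a unit by (simp add: w_def s_def field_simps)
  qed
  then show "(cmod a)\<^sup>2 = (1 - e $ 3) / 2" "(cmod b)\<^sup>2 = (1 + e $ 3) / 2"
    "b * cnj a = - Complex (e $ 1) (e $ 2) / 2" by auto
qed

text \<open>Equal Hopf coordinates mean equal rank-one projectors, so the two unit vectors of
  \<open>C^2\<close> span the same line. The phase between them is their Hermitian product.\<close>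

lemma unit_spinor_unique:
  assumes "cmod a ^ 2 = cmod a' ^ 2" "cmod b ^ 2 = cmod b' ^ 2" "b * cnj a = b' * cnj a'"
    and unit: "cmod a ^ 2 + cmod b ^ 2 = 1"
  obtains w where "cmod w = 1" "a = w * a'" "b = w * b'"
proof
  define w where "w = a * cnj a' + b * cnj b'"
  have n: "a * cnj a = a' * cnj a'" "b * cnj b = b' * cnj b'"
    using assms(1,2) by (metis complex_norm_square)+
  have u: "a * cnj a + b * cnj b = 1"
    using unit by (metis complex_norm_square of_real_1 of_real_add)
  have c: "cnj b * a = cnj b' * a'"
    using arg_cong[OF assms(3), of cnj] by simp
  have "w * a' = a * (a' * cnj a') + b * (cnj b' * a')" by (simp add: w_def algebra_simps)
  also have "\<dots> = a * (a * cnj a + b * cnj b)"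
    unfolding n[symmetric] c[symmetric] by (simp add: algebra_simps)
  finally show a: "a = w * a'" by (simp add: u)
  have "w * b' = a * (b' * cnj a') + b * (b' * cnj b')" by (simp add: w_def algebra_simps)
  also have "\<dots> = b * (a * cnj a + b * cnj b)"
    unfolding n[symmetric] assms(3)[symmetric] by (simp add: algebra_simps)
  finally show b: "b = w * b'" by (simp add: u)
  have "cmod w ^ 2 * (cmod a' ^ 2 + cmod b' ^ 2) = 1"
    using unit by (simp add: a b norm_mult power_mult_distrib algebra_simps)
  then have "cmod w ^ 2 = 1 ^ 2" using assms by simp
  then show "cmod w = 1" by (rule power2_eq_imp_eq) simp_all
qed

text \<open>Isotropy reads \<open>(m1 + i m2) (m1 - i m2) = - m3^2\<close>, which makes the
  prescribed values of \<open>q^2\<close>, \<open>P^2\<close> and \<open>P q\<close> compatible. The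
  norm condition makes the spinor a unit vector.\<close>

lemma isotropic_spinor:
  fixes m1 m2 m3 :: complex
  assumes iso: "m1\<^sup>2 + m2\<^sup>2 + m3\<^sup>2 = 0" and n: "(cmod m1)\<^sup>2 + (cmod m2)\<^sup>2 + (cmod m3)\<^sup>2 = 2"
  obtains P q where "q\<^sup>2 = (m1 + \<i> * m2) / 2" "P\<^sup>2 = - (m1 - \<i> * m2) / 2" "P * q = - m3 / 2"
    "(cmod P)\<^sup>2 + (cmod q)\<^sup>2 = 1"
proof -
  define q where "q = csqrt ((m1 + \<i> * m2) / 2)"
  define R where "R = csqrt (- (m1 - \<i> * m2) / 2)"
  \<comment> \<open>the two square roots are determined up to sign; the product fixes the relative sign\<close>
  define P where "P = (if R * q = - m3 / 2 then R else - R)"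
  have q: "q\<^sup>2 = (m1 + \<i> * m2) / 2" by (simp add: q_def)
  have R: "R\<^sup>2 = - (m1 - \<i> * m2) / 2" unfolding R_def by (rule power2_csqrt)
  have "(R * q)\<^sup>2 = - (m1\<^sup>2 + m2\<^sup>2) / 4"
    unfolding power_mult_distrib q R by (simp add: field_simps power2_eq_square)
  also have "\<dots> = (m3 / 2)\<^sup>2"
    using iso by (simp add: power_divide add_eq_0_iff eq_neg_iff_add_eq_0)
  finally have Pq: "P * q = - m3 / 2" by (auto simp: P_def power2_eq_iff)
  have P: "P\<^sup>2 = - (m1 - \<i> * m2) / 2" using R by (auto simp: P_def)
  have parallelogram:
    "(cmod (m1 + \<i> * m2))\<^sup>2 + (cmod (m1 - \<i> * m2))\<^sup>2 = 2 * ((cmod m1)\<^sup>2 + (cmod m2)\<^sup>2)"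
    unfolding cmod_power2 by (simp add: power2_eq_square algebra_simps)
  have "((cmod P)\<^sup>2 + (cmod q)\<^sup>2)\<^sup>2 = (cmod (P\<^sup>2))\<^sup>2 + (cmod (q\<^sup>2))\<^sup>2 + 2 * (cmod (P * q))\<^sup>2"
    by (simp add: power2_sum norm_mult norm_power power_mult_distrib)
  also have "\<dots> = ((cmod m1)\<^sup>2 + (cmod m2)\<^sup>2 + (cmod m3)\<^sup>2) / 2"
    unfolding P q Pq norm_divide norm_minus_cancel power_divide using parallelogram by simp
  finally have "(cmod P)\<^sup>2 + (cmod q)\<^sup>2 = 1"
    unfolding n by (simp add: power2_eq_1_iff) (metis add_nonneg_nonneg neg_0_le_iff_le not_one_le_zero zero_le_power2)
  with q P Pq that show ?thesis by blast
qed

text \<open>Put \<open>f = (P, - q)\<close> and \<open>g = (cnj q, cnj P)\<close>, the rows of a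
  matrix in SU(2). Every unit lift of a direction in the plane of \<open>u\<close> and
  \<open>v\<close> is then a phase times \<open>(\<epsilon> f + g) / sqrt 2\<close>, because this
  form has the Hopf coordinates of the direction.\<close>

lemma spin_frame:
  fixes u v :: "real^3"
  assumes "norm u = 1" "norm v = 1" "u \<bullet> v = 0"
  obtains P q where "(cmod P)\<^sup>2 + (cmod q)\<^sup>2 = 1"
    "\<And>\<epsilon> a b. cmod \<epsilon> = 1 \<Longrightarrow> (cmod a)\<^sup>2 + (cmod b)\<^sup>2 = 1 \<Longrightarrow>
       root_at a b (stereo (Re \<epsilon> *\<^sub>R u - Im \<epsilon> *\<^sub>R v)) \<Longrightarrow>
       \<exists>w. cmod w = 1 \<and> a = w / sqrt 2 * (\<epsilon> * P + cnj q) \<and> b = w / sqrt 2 * (cnj P - \<epsilon> * q)"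
proof -
  have nu: "(u $ 1)\<^sup>2 + (u $ 2)\<^sup>2 + (u $ 3)\<^sup>2 = 1" and nv: "(v $ 1)\<^sup>2 + (v $ 2)\<^sup>2 + (v $ 3)\<^sup>2 = 1"
    using assms by (simp_all add: norm_vec_def L2_set_def sum_3)
  have uv: "u $ 1 * v $ 1 + u $ 2 * v $ 2 + u $ 3 * v $ 3 = 0"
    using assms by (simp add: inner_vec_def sum_3)
  define m where "m = (\<lambda>k::3. Complex (u $ k) (v $ k))"
  have "(m 1)\<^sup>2 + (m 2)\<^sup>2 + (m 3)\<^sup>2 = 0"
    using nu nv uv by (simp add: m_def complex_eq_iff power2_eq_square algebra_simps)
  moreover have "(cmod (m 1))\<^sup>2 + (cmod (m 2))\<^sup>2 + (cmod (m 3))\<^sup>2 = 2"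
    using nu nv by (simp add: m_def cmod_power2)
  ultimately obtain P q where q: "q\<^sup>2 = (m 1 + \<i> * m 2) / 2" and P: "P\<^sup>2 = - (m 1 - \<i> * m 2) / 2"
    and Pq: "P * q = - m 3 / 2" and n: "(cmod P)\<^sup>2 + (cmod q)\<^sup>2 = 1"
    using isotropic_spinor by metis
  show ?thesis
  proof (rule that[OF n])
    fix \<epsilon> a b assume \<epsilon>: "cmod \<epsilon> = 1" and ab: "(cmod a)\<^sup>2 + (cmod b)\<^sup>2 = 1"
      and root: "root_at a b (stereo (Re \<epsilon> *\<^sub>R u - Im \<epsilon> *\<^sub>R v))"
    define e where "e = Re \<epsilon> *\<^sub>R u - Im \<epsilon> *\<^sub>R v"
    have ek: "e $ k = Re (\<epsilon> * m k)" for k by (simp add: e_def m_def)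
    have "(norm e)\<^sup>2 = (Re \<epsilon>)\<^sup>2 * (u \<bullet> u) + (Im \<epsilon>)\<^sup>2 * (v \<bullet> v) - 2 * Re \<epsilon> * Im \<epsilon> * (u \<bullet> v)"
      unfolding power2_norm_eq_inner e_def
      by (simp add: inner_diff_left inner_diff_right inner_commute power2_eq_square algebra_simps)
    also have "\<dots> = 1" using assms \<epsilon> by (simp add: norm_eq_1 cmod_def)
    finally have "norm e = 1" by (simp add: power2_eq_1_iff) (metis norm_ge_zero neg_0_le_iff_le not_one_le_zero)
    note c = unit_lift_coords[OF this ab root[folded e_def]]
    have \<epsilon>1: "\<epsilon> * cnj \<epsilon> = 1" using \<epsilon> by (simp add: complex_norm_square[symmetric])
    define a' b' where "a' = (\<epsilon> * P + cnj q) / sqrt 2" and "b' = (cnj P - \<epsilon> * q) / sqrt 2"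
    have sq2: "complex_of_real (sqrt 2) * complex_of_real (sqrt 2) = 2"
      by (simp flip: of_real_mult)
    have nc: "P * cnj P + q * cnj q = 1"
      using n by (metis complex_norm_square of_real_1 of_real_add)
    have "2 * Re (\<epsilon> * (P * q)) = - e $ 3" by (simp add: Pq ek field_simps)
    then have Re2: "\<epsilon> * (P * q) + cnj (\<epsilon> * (P * q)) = of_real (- e $ 3)"
      unfolding complex_add_cnj by simp
    have "a' * cnj a' = (\<epsilon> * cnj \<epsilon> * P * cnj P + q * cnj q + (\<epsilon> * (P * q) + cnj (\<epsilon> * (P * q)))) / 2"
      by (simp add: a'_def sq2 algebra_simps add_divide_distrib)
    also have "\<dots> = of_real ((1 - e $ 3) / 2)"
      unfolding \<epsilon>1 Re2 using nc by simp
    finally have a': "(cmod a')\<^sup>2 = (1 - e $ 3) / 2"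
      by (metis complex_norm_square of_real_eq_iff)
    have "b' * cnj b' = (P * cnj P + \<epsilon> * cnj \<epsilon> * q * cnj q - (\<epsilon> * (P * q) + cnj (\<epsilon> * (P * q)))) / 2"
      by (simp add: b'_def sq2 algebra_simps add_divide_distrib diff_divide_distrib)
    also have "\<dots> = of_real ((1 + e $ 3) / 2)"
      unfolding \<epsilon>1 Re2 using nc by simp
    finally have b': "(cmod b')\<^sup>2 = (1 + e $ 3) / 2"
      by (metis complex_norm_square of_real_eq_iff)
    \<comment> \<open>The mixed term vanishes for unit \<open>\<epsilon>\<close>; the squares
      \<open>P^2\<close> and \<open>q^2\<close> that remain are given by the first two coordinates
      of the isotropic vector.\<close>
    have "b' * cnj a' = (cnj (\<epsilon> * P\<^sup>2) - \<epsilon> * q\<^sup>2 + (1 - \<epsilon> * cnj \<epsilon>) * q * cnj P) / 2"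
      by (simp add: a'_def b'_def sq2 power2_eq_square algebra_simps add_divide_distrib diff_divide_distrib)
    also have "\<dots> = - Complex (e $ 1) (e $ 2) / 2"
      unfolding \<epsilon>1 P q ek by (simp add: complex_eq_iff field_simps)
    finally have "b' * cnj a' = - Complex (e $ 1) (e $ 2) / 2" .
    with a' b' obtain w where "cmod w = 1" "a = w * a'" "b = w * b'"
      using unit_spinor_unique[of a a' b b'] c ab by metis
    then show "\<exists>w. cmod w = 1 \<and> a = w / sqrt 2 * (\<epsilon> * P + cnj q) \<and> b = w / sqrt 2 * (cnj P - \<epsilon> * q)"
      by (auto simp: a'_def b'_def)
  qed
qed

section \<open>Points on a circle\<close>

text \<open>An affine hull of three points has dimension at most 2, hence lies in a hyperplane,
  which is a null set.\<close>

lemma tetra_volume_coplanar: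
  assumes "coplanar (x ` {1..4})"
  shows "tetra_volume x = 0"
proof -
  obtain p q r where s: "x ` {1..4} \<subseteq> affine hull {p, q, r}"
    using assms by (auto simp: coplanar_def)
  have "card {p, q, r} \<le> 3" by (simp add: card_insert_if)
  then have "aff_dim {p, q, r} < DIM(real^3)"
    using aff_dim_le_card[of "{p, q, r}"] by simp
  then have "aff_dim (affine hull {p, q, r}) < DIM(real^3)" by simp
  then obtain n d where n: "n \<noteq> 0" "affine hull {p, q, r} \<subseteq> {y. n \<bullet> y = d}"
    by (rule aff_lowdim_subset_hyperplane)
  have "convex hull (x ` {1..4}) \<subseteq> {y. n \<bullet> y = d}"
    using s n(2) by (intro hull_minimal convex_hyperplane) auto
  then have "negligible (convex hull (x ` {1..4}))"
    using n(1) negligible_hyperplane negligible_subset by blast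
  then show ?thesis
    by (simp add: tetra_volume_def negligible_iff_measure)
qed

text \<open>In terms of the half sum \<open>p\<close> and half difference \<open>d\<close> both
  expressions have the factor \<open>cos p\<close>. The remaining factors are nonnegative because
  \<open>\<bar>d\<bar> \<le> p \<le> pi / 2\<close> gives
  \<open>cos d \<ge> cos p \<ge> 0\<close>.\<close>

lemma angle_ineqs:
  fixes s t :: real
  assumes "0 \<le> s" "0 \<le> t" "s + t \<le> pi"
  shows "cos s + cos t - cos (s + t) - 1 \<ge> 0"
    "5 + 3 * (cos s + cos t) + 5 * cos (s + t) \<ge> 0"
proof -
  define p d where "p = (s + t) / 2" and "d = (s - t) / 2"
  have "s + t = 2 * p" by (simp add: p_def)
  then have cc: "cos s + cos t = 2 * (cos p * cos d)" "cos (s + t) = 2 * (cos p)\<^sup>2 - 1"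
    using cos_plus_cos[of s t] cos_double_cos[of p] by (simp_all add: p_def[symmetric] d_def)
  have p: "cos p \<ge> 0" using assms by (intro cos_ge_zero) (auto simp: p_def)
  have "\<bar>d\<bar> \<le> p" "p \<le> pi" using assms by (auto simp: p_def d_def)
  then have d: "cos d \<ge> cos p"
    using cos_monotone_0_pi_le[of "\<bar>d\<bar>" p] by simp
  have "cos s + cos t - cos (s + t) - 1 = 2 * (cos p * (cos d - cos p))"
    unfolding cc by (simp add: algebra_simps power2_eq_square)
  then show "cos s + cos t - cos (s + t) - 1 \<ge> 0" using p d by simp
  have "5 + 3 * (cos s + cos t) + 5 * cos (s + t) = cos p * (10 * cos p + 6 * cos d)"
    unfolding cc by (simp add: algebra_simps power2_eq_square)
  then show "5 + 3 * (cos s + cos t) + 5 * cos (s + t) \<ge> 0" using p d by simp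
qed

text \<open>By the sum-to-product formulas a chord is parallel to the tangent at the mean angle. The
  bounds on \<open>t - s\<close> make the coefficient positive, so it is the length and no sign
  enters the direction.\<close>

lemma dist_circle:
  fixes u v c :: "'a::real_inner" and \<rho> :: real
  assumes "norm u = 1" "norm v = 1" "u \<bullet> v = 0"
  defines "x \<equiv> \<lambda>\<theta>. c + \<rho> *\<^sub>R (cos \<theta> *\<^sub>R u + sin \<theta> *\<^sub>R v)"
  assumes "\<rho> > 0" "s < t" "t < s + 2 * pi"
  shows "x t - x s = dist (x s) (x t) *\<^sub>R (- sin ((s + t) / 2) *\<^sub>R u + cos ((s + t) / 2) *\<^sub>R v)"
    and "dist (x s) (x t) = 2 * \<rho> * sin ((t - s) / 2)"
proof -
  define h g where "h = (t - s) / 2" and "g = (s + t) / 2"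
  have d: "x t - x s = (2 * \<rho> * sin h) *\<^sub>R (- sin g *\<^sub>R u + cos g *\<^sub>R v)"
    (is "_ = _ *\<^sub>R ?e")
  proof -
    have "sin ((s - t) / 2) = - sin ((t - s) / 2)"
      by (metis minus_diff_eq minus_divide_left sin_minus)
    then have "cos t - cos s = - 2 * sin h * sin g" "sin t - sin s = 2 * sin h * cos g"
      using cos_diff_cos[of t s] sin_diff_sin[of t s]
      by (simp_all add: h_def g_def add.commute)
    then have c: "cos t = cos s - 2 * sin h * sin g" and s: "sin t = sin s + 2 * sin h * cos g" by simp_all
    show ?thesis unfolding x_def c s by (simp add: algebra_simps)
  qed
  have pos: "sin h > 0" using assms by (intro sin_gt_zero) (auto simp: h_def)
  have "(norm ?e)\<^sup>2 = (sin g)\<^sup>2 * (u \<bullet> u) + (cos g)\<^sup>2 * (v \<bullet> v) - 2 * sin g * cos g * (u \<bullet> v)"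
    unfolding power2_norm_eq_inner
    by (simp add: inner_add_left inner_add_right inner_diff_left inner_diff_right inner_commute power2_eq_square algebra_simps)
  also have "\<dots> = 1" using assms by (simp add: norm_eq_1)
  finally have e: "norm ?e = 1" by (simp add: power2_eq_1_iff) (metis norm_ge_zero neg_0_le_iff_le not_one_le_zero)
  have "dist (x s) (x t) = norm (x t - x s)" by (simp add: dist_norm norm_minus_commute)
  also have "\<dots> = 2 * \<rho> * sin h" unfolding d norm_scaleR e using pos \<open>\<rho> > 0\<close> by simp
  finally show "dist (x s) (x t) = 2 * \<rho> * sin ((t - s) / 2)"
    and "x t - x s = dist (x s) (x t) *\<^sub>R (- sin ((s + t) / 2) *\<^sub>R u + cos ((s + t) / 2) *\<^sub>R v)"
    using d by (simp_all add: h_def g_def)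
qed

text \<open>By the law of sines these are the sides of a triangle with angles \<open>s\<close>,
  \<open>t\<close>, \<open>pi - s - t\<close> in a circle of diameter \<open>k\<close>. Since
  \<open>d3\<close> is homogeneous of degree 3, the case \<open>k = 1\<close> suffices.\<close>

lemma d3_chords:
  fixes k s t :: real
  shows "d3 (k * sin s) (k * sin (s + t)) (k * sin t) =
    2 * (cos s + cos t - cos (s + t) - 1) * (k * sin s * (k * sin (s + t)) * (k * sin t))"
proof -
  have "d3 (sin s) (sin (s + t)) (sin t) =
      2 * (cos s + cos t - cos (s + t) - 1) * (sin s * sin (s + t) * sin t)"
    using sin_cos_squared_add[of s] sin_cos_squared_add[of t]
    unfolding d3_def sin_add cos_add by algebra
  moreover have "d3 (k * a) (k * b) (k * c) = k ^ 3 * d3 a b c" for a b c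
    by (simp add: d3_def algebra_simps power3_eq_cube)
  ultimately show ?thesis by (simp add: power3_eq_cube)
qed

section \<open>The Atiyah determinant of concyclic points\<close>

text \<open>Polynomials list the constant term first, whereas pairs put the leading coefficient
  first; hence the swapped order in \<open>l'\<close> compared with \<open>lin_form\<close>.\<close>

lemma atiyah_matrix_rows:
  fixes a b :: "nat \<Rightarrow> nat \<Rightarrow> complex"
  defines "l \<equiv> \<lambda>i j. (a i j, b i j)" and "l' \<equiv> \<lambda>i j. (- cnj (b i j), cnj (a i j))"
  shows "atiyah_matrix a b = vector [cubic_row (l 1 2) (l 1 3) (l 1 4),
    cubic_row (l' 1 2) (l 2 3) (l 2 4), cubic_row (l' 1 3) (l' 2 3) (l 3 4),
    cubic_row (l' 1 4) (l' 2 4) (l' 3 4)]"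
proof -
  have "{1..4} - {1} = {2, 3, 4::nat}" "{1..4} - {2} = {1, 3, 4::nat}"
    "{1..4} - {3} = {1, 2, 4::nat}" "{1..4} - {4} = {1, 2, 3::nat}" by auto
  then have p: "atiyah_poly a b 1 = lin_form a b 1 2 * lin_form a b 1 3 * lin_form a b 1 4"
    "atiyah_poly a b 2 = lin_form a b 2 1 * lin_form a b 2 3 * lin_form a b 2 4"
    "atiyah_poly a b 3 = lin_form a b 3 1 * lin_form a b 3 2 * lin_form a b 3 4"
    "atiyah_poly a b 4 = lin_form a b 4 1 * lin_form a b 4 2 * lin_form a b 4 3"
    by (simp_all add: atiyah_poly_def mult.assoc)
  have up: "lin_form a b i j = [:b i j, a i j:]" if "i < j" for i j
    using that by (simp add: lin_form_def)
  have down: "lin_form a b j i = [:cnj (a i j), - cnj (b i j):]" if "i < j" for i j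
    using that by (simp add: lin_form_def)
  have idx: "(1::nat) - 1 = 0" "2 - 1 = (1::nat)" "3 - 1 = (2::nat)" "4 - 1 = (3::nat)"
    and lt: "(1::nat) < 2" "(1::nat) < 3" "(1::nat) < 4" "(2::nat) < 3" "(2::nat) < 4" "(3::nat) < 4"
    by simp_all
  show ?thesis
    unfolding atiyah_matrix_def l_def l'_def cubic_row_eq_coeff list.map p idx
      lt[THEN up] lt[THEN down]
    by (rule refl)
qed

text \<open>By \<open>spin_frame\<close> each lift is a scaled form in the basis adapted to the
  plane, with parameter \<open>y i * y j\<close>. Scalars and basis change factor out of the
  determinant, and \<open>det_concyclic\<close> evaluates the rest.\<close>

lemma atiyah_D4_concyclic:
  fixes x :: "nat \<Rightarrow> real^3"
  assumes frame: "norm u = 1" "norm v = 1" "u \<bullet> v = 0" and \<rho>: "\<rho> > 0"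
    and \<theta>: "\<theta> 1 < \<theta> 2" "\<theta> 2 < \<theta> 3" "\<theta> 3 < \<theta> 4" "\<theta> 4 < \<theta> 1 + 2 * pi"
    and x: "\<forall>i\<in>{1..4}. x i = c + \<rho> *\<^sub>R (cos (\<theta> i) *\<^sub>R u + sin (\<theta> i) *\<^sub>R v)"
    and lifts: "admissible x a b"
  defines "C \<equiv> \<lambda>i j. cos ((\<theta> j - \<theta> i) / 2)"
  defines "Q \<equiv> \<lambda>i j k. 2 * (C i j + C j k - C i k - 1)"
  shows "atiyah_D4 x a b = of_real (edge_prod x *
    (64 + 2 * (Q 2 3 4 * (3 + C 2 3 + C 3 4 + C 2 4) + Q 1 3 4 * (3 + C 3 4 - C 1 4 - C 1 3) +
      Q 1 2 4 * (3 + C 1 2 - C 2 4 - C 1 4) + Q 1 2 3 * (3 + C 1 2 + C 2 3 + C 1 3))))"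
proof -
  \<comment> \<open>the shift by pi / 4 accounts for the chord being orthogonal to the mean polar angle\<close>
  define y where "y = (\<lambda>i. cis (- \<theta> i / 2 - pi / 4))"
  have y0: "y i \<noteq> 0" for i by (simp add: y_def)
  have yy: "y i * y j = Complex (- sin ((\<theta> i + \<theta> j) / 2)) (- cos ((\<theta> i + \<theta> j) / 2))" for i j
  proof -
    have "y i * y j = cis (- ((\<theta> i + \<theta> j) / 2 + pi / 2))"
      unfolding y_def cis_mult by (rule arg_cong[of _ _ cis]) (simp add: field_simps)
    also have "\<dots> = Complex (- sin ((\<theta> i + \<theta> j) / 2)) (- cos ((\<theta> i + \<theta> j) / 2))"
      unfolding complex_eq_iff cis.sel complex.sel cos_minus sin_minus cos_add sin_add by simp
    finally show ?thesis .
  qed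
  have dir: "dir_pt x i j = stereo (Re (y i * y j) *\<^sub>R u - Im (y i * y j) *\<^sub>R v)"
    if ij: "i \<in> {1..4}" "j \<in> {1..4}" "i < j" for i j
  proof -
    have lt: "\<theta> i < \<theta> j" "\<theta> j < \<theta> i + 2 * pi"
    proof -
      have "i = 1 \<or> i = 2 \<or> i = 3" "j = 2 \<or> j = 3 \<or> j = 4" using ij by auto
      then show "\<theta> i < \<theta> j" "\<theta> j < \<theta> i + 2 * pi" using \<theta> ij(3) by auto
    qed
    have "x i \<noteq> x j"
      using dist_circle(2)[OF frame \<rho> lt, of c] x ij sin_gt_zero[of "(\<theta> j - \<theta> i) / 2"] lt \<rho> by auto
    then show ?thesis
      using dist_circle(1)[OF frame \<rho> lt, of c] x ij by (simp add: dir_pt_def yy)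
  qed
  obtain P q where Pq: "(cmod P)\<^sup>2 + (cmod q)\<^sup>2 = 1" and
    lift: "\<And>\<epsilon> a b. cmod \<epsilon> = 1 \<Longrightarrow> (cmod a)\<^sup>2 + (cmod b)\<^sup>2 = 1 \<Longrightarrow>
       root_at a b (stereo (Re \<epsilon> *\<^sub>R u - Im \<epsilon> *\<^sub>R v)) \<Longrightarrow>
       \<exists>w. cmod w = 1 \<and> a = w / sqrt 2 * (\<epsilon> * P + cnj q) \<and> b = w / sqrt 2 * (cnj P - \<epsilon> * q)"
    using spin_frame[OF frame] by metis
  define lifted where "lifted = (\<lambda>i j w. cmod w = 1 \<and> a i j = w / sqrt 2 * (y i * y j * P + cnj q) \<and>
      b i j = w / sqrt 2 * (cnj P - y i * y j * q))"
  define w where "w = (\<lambda>i j. SOME z. lifted i j z)"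
  have "lifted i j (w i j)" if ij: "i \<in> {1..4}" "j \<in> {1..4}" "i < j" for i j
    unfolding w_def
  proof (rule someI_ex)
    show "\<exists>z. lifted i j z"
      unfolding lifted_def
    proof (rule lift)
      show "cmod (y i * y j) = 1" by (simp add: y_def norm_mult)
    qed (use lifts ij in \<open>auto simp only: admissible_def dir[OF ij, symmetric]\<close>)
  qed
  then have w: "cmod (w i j) = 1" "a i j = w i j / sqrt 2 * (y i * y j * P + cnj q)"
      "b i j = w i j / sqrt 2 * (cnj P - y i * y j * q)"
    if "i \<in> {1..4}" "j \<in> {1..4}" "i < j" for i j
    using that by (simp_all add: lifted_def)
  define f where "f = (\<lambda>i j. w i j / sqrt 2)"
  define g where "g = (\<lambda>i j. cnj (w i j) / sqrt 2)"
  have fg: "f i j * g i j = 1 / 2" if "i \<in> {1..4}" "j \<in> {1..4}" "i < j" for i j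
  proof -
    have "complex_of_real (sqrt 2) * complex_of_real (sqrt 2) = 2"
      by (simp flip: of_real_mult)
    then show ?thesis using w(1)[OF that]
      by (simp add: f_def g_def complex_norm_square[symmetric])
  qed
  have ab: "(a i j, b i j) = (f i j * (y i * y j * P + 1 * cnj q),
      f i j * (y i * y j * (- q) + 1 * cnj P))"
    if "i \<in> {1..4}" "j \<in> {1..4}" "i < j" for i j
    using w(2,3)[OF that] by (simp add: f_def)
  \<comment> \<open>The opposite form carries the conjugate phase, and
    \<open>cnj (y i * y j)\<close> is the inverse of \<open>y i * y j\<close> because the
    \<open>y i\<close> are unit numbers.\<close>
  have ba: "(- cnj (b i j), cnj (a i j)) = (g i j * ((- 1) * P + 1 / (y i * y j) * cnj q),
      g i j * ((- 1) * (- q) + 1 / (y i * y j) * cnj P))"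
    if "i \<in> {1..4}" "j \<in> {1..4}" "i < j" for i j
  proof -
    define z where "z = y i * y j"
    have "cmod z = 1" by (simp add: z_def y_def norm_mult)
    from divide_conv_cnj[OF this, of 1] have z: "1 / z = cnj z" by simp
    show ?thesis
      unfolding g_def z_def[symmetric] z w(2,3)[OF that] by (simp add: algebra_simps diff_divide_distrib)
  qed
  define N where "N = (let e = \<lambda>i j. (y i * y j, 1); e' = \<lambda>i j. (- 1, 1 / (y i * y j)) in
      vector [cubic_row (e 1 2) (e 1 3) (e 1 4), cubic_row (e' 1 2) (e 2 3) (e 2 4),
      cubic_row (e' 1 3) (e' 2 3) (e 3 4), cubic_row (e' 1 4) (e' 2 4) (e' 3 4)] :: complex^4^4)"
  have "det (atiyah_matrix a b) = f 1 2 * f 1 3 * f 1 4 * (g 1 2 * f 2 3 * f 2 4) *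
      (g 1 3 * g 2 3 * f 3 4) * (g 1 4 * g 2 4 * g 3 4) * det N *
      det (sym3 (P, - q) (cnj q, cnj P))"
    unfolding atiyah_matrix_rows
    by (simp only: ab ba atLeastAtMost_iff one_le_numeral order_refl numeral_le_iff semiring_norm
        one_less_numeral_iff numeral_less_iff simp_thms cubic_row_scale cubic_row_change
        det_scaled_rows_mul N_def Let_def)
  also have "det (sym3 (P, - q) (cnj q, cnj P)) = (P * cnj P + q * cnj q) ^ 6"
    by (simp add: det_sym3)
  also have "P * cnj P + q * cnj q = 1"
    using Pq by (metis complex_norm_square of_real_1 of_real_add)
  also have "f 1 2 * f 1 3 * f 1 4 * (g 1 2 * f 2 3 * f 2 4) *
      (g 1 3 * g 2 3 * f 3 4) * (g 1 4 * g 2 4 * g 3 4) =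
      (f 1 2 * g 1 2) * (f 1 3 * g 1 3) * (f 1 4 * g 1 4) * (f 2 3 * g 2 3) * (f 2 4 * g 2 4) *
      (f 3 4 * g 3 4)" by (simp only: ac_simps)
  \<comment> \<open>Grouped by edge, the phases cancel and each of the six pairs contributes 1/2;
    this absorbs the normalizing factor 64.\<close>
  also have "\<dots> = 1 / 64" by (simp add: fg)
  finally have det: "64 * det (atiyah_matrix a b) = det N" by (simp add: mult.commute)
  have C: "(y i / y j + y j / y i) / 2 = of_real (C i j)" for i j
  proof -
    have "y i / y j = cis ((\<theta> j - \<theta> i) / 2)" "y j / y i = cis (- ((\<theta> j - \<theta> i) / 2))"
      unfolding y_def cis_divide by (rule arg_cong[of _ _ cis]; simp add: field_simps)+
    then show ?thesis by (simp add: C_def complex_eq_iff)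
  qed
  have detN: "det N = of_real (64 + 2 * (Q 2 3 4 * (3 + C 2 3 + C 3 4 + C 2 4) +
      Q 1 3 4 * (3 + C 3 4 - C 1 4 - C 1 3) + Q 1 2 4 * (3 + C 1 2 - C 2 4 - C 1 4) +
      Q 1 2 3 * (3 + C 1 2 + C 2 3 + C 1 3)))"
    unfolding N_def Let_def det_concyclic[of y, OF y0] C by (simp add: Q_def)
  have "atiyah_D4 x a b = of_real (edge_prod x) * (64 * det (atiyah_matrix a b))"
    by (simp add: atiyah_D4_def)
  then show ?thesis unfolding det detN by (simp only: of_real_mult)
qed

section \<open>The inequality for each omitted vertex, and the sum\<close>

text \<open>The difference of the two sides is half the product of \<open>Q\<close> and the second
  expression in \<open>angle_ineqs\<close>; the first one says that \<open>Q\<close> is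
  nonnegative.\<close>

lemma termwise_ineq:
  fixes s t :: real
  assumes "0 \<le> s" "0 \<le> t" "s + t \<le> pi"
  defines "Q \<equiv> 2 * (cos s + cos t - cos (s + t) - 1)"
  shows "(4 + 1/4 * Q) * Q \<le> 2 * (Q * (3 + cos s + cos t + cos (s + t)))"
proof -
  have "0 \<le> Q * (5 + 3 * (cos s + cos t) + 5 * cos (s + t))"
    using angle_ineqs[OF assms(1-3)] by (simp add: Q_def)
  then show ?thesis by (simp add: Q_def algebra_simps)
qed

theorem proposition2p12:
  fixes x :: "nat \<Rightarrow> real^3" and a b :: "nat \<Rightarrow> nat \<Rightarrow> complex"
  assumes distinct: "inj_on x {1..4}"
    and planar: "coplanar (x ` {1..4})"
    and cyclic: "consecutive_on_circle x"
    and lifts: "admissible x a b"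
  shows "let r = (\<lambda>i j. dist (x i) (x j)); V = tetra_volume x in
    Re (atiyah_D4 x a b) - (4 + 3/4) * (288 * V\<^sup>2) \<ge>
      64 * edge_prod x +
      (\<Sum>(l, i, j, k)\<in>{(1, 2, 3, 4), (2, 1, 3, 4), (3, 1, 2, 4), (4, 1, 2, 3)}.
        (4 + 1/4 * (d3 (r i j) (r i k) (r j k) / (r i j * r i k * r j k))) *
        (r i l * r j l * r k l) * d3 (r i j) (r i k) (r j k))"
proof -
  obtain c u v \<rho> \<theta> where frame: "norm u = 1" "norm v = 1" "u \<bullet> v = 0" and \<rho>: "\<rho> > 0"
    and \<theta>: "\<theta> 1 < \<theta> 2" "\<theta> 2 < \<theta> 3" "\<theta> 3 < \<theta> 4" "\<theta> 4 < \<theta> 1 + 2 * pi"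
    and x: "\<forall>i\<in>{1..4}. x i = c + \<rho> *\<^sub>R (cos (\<theta> i) *\<^sub>R u + sin (\<theta> i) *\<^sub>R v)"
    using cyclic unfolding consecutive_on_circle_def by blast
  define h where "h = (\<lambda>i j. (\<theta> j - \<theta> i) / 2)"
  define r where "r = (\<lambda>i j. dist (x i) (x j))"
  define Q where "Q = (\<lambda>i j k. 2 * (cos (h i j) + cos (h j k) - cos (h i k) - 1))"
  define T where "T = (\<lambda>l i j k. (4 + 1/4 * (d3 (r i j) (r i k) (r j k) / (r i j * r i k * r j k))) *
        (r i l * r j l * r k l) * d3 (r i j) (r i k) (r j k))"
  have sym: "r i j = r j i" for i j by (simp add: r_def dist_commute)
  have lt: "\<theta> i < \<theta> j" "\<theta> j < \<theta> i + 2 * pi" if "i \<in> {1..4}" "j \<in> {1..4}" "i < j" for i j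
  proof -
    have "i = 1 \<or> i = 2 \<or> i = 3" "j = 2 \<or> j = 3 \<or> j = 4" using that by auto
    then show "\<theta> i < \<theta> j" "\<theta> j < \<theta> i + 2 * pi" using \<theta> that(3) by auto
  qed
  have r: "r i j = 2 * \<rho> * sin (h i j)" "r i j > 0" if ij: "i \<in> {1..4}" "j \<in> {1..4}" "i < j" for i j
  proof -
    show "r i j = 2 * \<rho> * sin (h i j)"
      using dist_circle(2)[OF frame \<rho> lt[OF ij], of c] x ij by (simp add: r_def h_def)
    moreover have "sin (h i j) > 0" using lt[OF ij] by (intro sin_gt_zero) (auto simp: h_def)
    ultimately show "r i j > 0" using \<rho> by simp
  qed
  have E: "edge_prod x = r 1 2 * r 1 3 * r 1 4 * r 2 3 * r 2 4 * r 3 4"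
    by (simp add: edge_prod_expand r_def)
  have E0: "edge_prod x \<ge> 0" unfolding E by (simp add: r_def)
  \<comment> \<open>The premise \<open>split\<close> sorts the six edges into the three at vertex
    \<open>l\<close> and the sides of the opposite triangle. The factor \<open>d3\<close> supplies
    the latter.\<close>
  have T: "T l i j k = edge_prod x * ((4 + 1/4 * Q i j k) * Q i j k)"
    if ijk: "i \<in> {1..4}" "j \<in> {1..4}" "k \<in> {1..4}" "i < j" "j < k"
      and split: "edge_prod x = (r i l * r j l * r k l) * (r i j * r i k * r j k)" for l i j k
  proof -
    have "h i k = h i j + h j k" by (simp add: h_def field_simps)
    then have d: "d3 (r i j) (r i k) (r j k) = Q i j k * (r i j * r i k * r j k)"
      using d3_chords[of "2 * \<rho>" "h i j" "h j k"] ijk by (simp add: r Q_def)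
    have "r i j * r i k * r j k \<noteq> 0" using r(2)[of i j] r(2)[of i k] r(2)[of j k] ijk by simp
    then have "d3 (r i j) (r i k) (r j k) / (r i j * r i k * r j k) = Q i j k"
      unfolding d by (rule nonzero_mult_div_cancel_right)
    then show ?thesis unfolding T_def split d by (simp only: ac_simps)
  qed
  have h: "cos (pi - h i k) = - cos (h i k)" for i k by simp
  have ineqs: "(4 + 1/4 * Q 2 3 4) * Q 2 3 4 \<le>
      2 * (Q 2 3 4 * (3 + cos (h 2 3) + cos (h 3 4) + cos (h 2 4)))"
    "(4 + 1/4 * Q 1 3 4) * Q 1 3 4 \<le>
      2 * (Q 1 3 4 * (3 + cos (h 3 4) - cos (h 1 4) - cos (h 1 3)))"
    "(4 + 1/4 * Q 1 2 4) * Q 1 2 4 \<le>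
      2 * (Q 1 2 4 * (3 + cos (h 1 2) - cos (h 2 4) - cos (h 1 4)))"
    "(4 + 1/4 * Q 1 2 3) * Q 1 2 3 \<le>
      2 * (Q 1 2 3 * (3 + cos (h 1 2) + cos (h 2 3) + cos (h 1 3)))"
  proof -
    have pos: "h 1 2 \<ge> 0" "h 2 3 \<ge> 0" "h 3 4 \<ge> 0" "h 1 4 \<le> pi" "h 1 3 \<ge> 0" "h 2 4 \<ge> 0"
      using \<theta> by (simp_all add: h_def)
    have add: "h 2 3 + h 3 4 = h 2 4" "h 1 2 + h 2 3 = h 1 3" "h 1 3 + h 3 4 = h 1 4"
        "h 1 2 + h 2 4 = h 1 4"
      by (simp_all add: h_def field_simps)
    \<comment> \<open>For the omitted vertices 2 and 3 the chord from 1 to 4 is seen under the angle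
      \<open>pi - h 1 4\<close>. Taking this as \<open>t\<close> in \<open>termwise_ineq\<close>
      turns \<open>s + t\<close> into the supplement of \<open>h 1 3\<close> or
      \<open>h 2 4\<close>, which produces the minus signs.\<close>
    have add': "h 3 4 + (pi - h 1 4) = pi - h 1 3" "h 1 2 + (pi - h 1 4) = pi - h 2 4"
      using add by simp_all
    show "(4 + 1/4 * Q 2 3 4) * Q 2 3 4 \<le>
      2 * (Q 2 3 4 * (3 + cos (h 2 3) + cos (h 3 4) + cos (h 2 4)))"
      using termwise_ineq[of "h 2 3" "h 3 4"] pos add by (simp add: Q_def)
    show "(4 + 1/4 * Q 1 2 3) * Q 1 2 3 \<le>
      2 * (Q 1 2 3 * (3 + cos (h 1 2) + cos (h 2 3) + cos (h 1 3)))"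
      using termwise_ineq[of "h 1 2" "h 2 3"] pos add by (simp add: Q_def)
    show "(4 + 1/4 * Q 1 3 4) * Q 1 3 4 \<le>
      2 * (Q 1 3 4 * (3 + cos (h 3 4) - cos (h 1 4) - cos (h 1 3)))"
      using termwise_ineq[of "h 3 4" "pi - h 1 4"] pos unfolding add' h Q_def
      by (simp add: algebra_simps)
    show "(4 + 1/4 * Q 1 2 4) * Q 1 2 4 \<le>
      2 * (Q 1 2 4 * (3 + cos (h 1 2) - cos (h 2 4) - cos (h 1 4)))"
      using termwise_ineq[of "h 1 2" "pi - h 1 4"] pos unfolding add' h Q_def
      by (simp add: algebra_simps)
  qed
  have Tl: "T 1 2 3 4 = edge_prod x * ((4 + 1/4 * Q 2 3 4) * Q 2 3 4)"
      "T 2 1 3 4 = edge_prod x * ((4 + 1/4 * Q 1 3 4) * Q 1 3 4)"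
      "T 3 1 2 4 = edge_prod x * ((4 + 1/4 * Q 1 2 4) * Q 1 2 4)"
      "T 4 1 2 3 = edge_prod x * ((4 + 1/4 * Q 1 2 3) * Q 1 2 3)"
    by (rule T; simp add: E sym ac_simps)+
  \<comment> \<open>\<open>K l\<close> is the contribution of the omitted vertex \<open>l\<close> to
    the determinant, after division by the edge product. Naming it keeps the final summation linear
    in four atoms.\<close>
  define K where "K = (\<lambda>l::nat.
      if l = 1 then 2 * (Q 2 3 4 * (3 + cos (h 2 3) + cos (h 3 4) + cos (h 2 4)))
      else if l = 2 then 2 * (Q 1 3 4 * (3 + cos (h 3 4) - cos (h 1 4) - cos (h 1 3)))
      else if l = 3 then 2 * (Q 1 2 4 * (3 + cos (h 1 2) - cos (h 2 4) - cos (h 1 4)))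
      else 2 * (Q 1 2 3 * (3 + cos (h 1 2) + cos (h 2 3) + cos (h 1 3))))"
  have "T 1 2 3 4 \<le> edge_prod x * K 1" "T 2 1 3 4 \<le> edge_prod x * K 2"
    "T 3 1 2 4 \<le> edge_prod x * K 3" "T 4 1 2 3 \<le> edge_prod x * K 4"
    unfolding Tl by (rule mult_left_mono[OF _ E0]; use ineqs in \<open>simp add: K_def\<close>)+
  moreover have "Re (atiyah_D4 x a b) = edge_prod x * (64 + (K 1 + K 2 + K 3 + K 4))"
    unfolding atiyah_D4_concyclic[OF frame \<rho> \<theta> x lifts]
    by (simp add: K_def Q_def h_def algebra_simps)
  ultimately have "64 * edge_prod x + (T 1 2 3 4 + T 2 1 3 4 + T 3 1 2 4 + T 4 1 2 3) \<le>
      Re (atiyah_D4 x a b)"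
    by (simp add: distrib_left)
  then show ?thesis
    by (simp add: Let_def tetra_volume_coplanar[OF planar] T_def r_def)
qed

end
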